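(* Let $\mathbb{F}$ be a field of characteristic $0$. With the addition $\lceil X\rceil\,\vec{\boxplus}\,\lceil Y\rceil:=\lceil X\,\vec{\boxplus}\,Y\rceil$ and the scalar product $a\lceil X\rceil:=\lceil aX\rceil$, $a\in\mathbb{F}$: (1) $\Omega_{\mathcal{V}}$ is a vector space over $\mathbb{F}$; (2) $\Omega_{\mathcal{V}}^i$, $i=1,2,\dots$, are subspaces of $\Omega_{\mathcal{V}}$; (3) if $i\mid j$, then $\Omega_{\mathcal{V}}^i$ is a subspace of $\Omega_{\mathcal{V}}^j$.
   Context: $\mathcal{V}=\bigcup_{i\ge1}\mathcal{V}_i$ is the set of all column vectors of all finite dimensions over $\mathbb{F}$, where $\mathcal{V}_i=\mathbb{F}^i$. $\otimes$ is the Kronecker product and $\mathbf{1}_s\in\mathbb{F}^s$ is the all-ones vector. $X\leftrightarrow Y$ means $X\otimes\mathbf{1}_s=Y\otimes\mathbf{1}_t$ for some positive integers $s,t$; $\lceil X\rceil$ is the class of $X$ and $\Omega_{\mathcal{V}}:=\mathcal{V}/\!\leftrightarrow$. For $X\in\mathcal{V}_p$, $Y\in\mathcal{V}_q$ and $t=\mathrm{lcm}(p,q)$, $X\,\vec{\boxplus}\,Y:=(X\otimes\mathbf{1}_{t/p})+(Y\otimes\mathbf{1}_{t/q})$; this is compatible with $\leftrightarrow$. $\Omega_{\mathcal{V}}^i:=\{\lceil X\rceil: X\in\mathcal{V}_i\}$, the set of classes having a representative in $\mathcal{V}_i$. *)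

theory Defs
  imports "Jordan_Normal_Form.VS_Connect"
begin

definition kron_vec :: "'a::times vec \<Rightarrow> 'a vec \<Rightarrow> 'a vec" (infixl \<open>\<otimes>\<^sub>v\<close> 75)
  where "X \<otimes>\<^sub>v Y = vec (dim_vec X * dim_vec Y) (\<lambda>k. X $ (k div dim_vec Y) * Y $ (k mod dim_vec Y))"

definition ones_vec :: "nat \<Rightarrow> 'a::one vec"
  where "ones_vec s = vec s (\<lambda>_. 1)"

text \<open>Vectors of dimension \<open>0\<close> exist in the type \<^typ>\<open>'a vec\<close> and are excluded here.\<close>

definition all_vecs :: "'a vec set"
  where "all_vecs = (\<Union>i\<in>{1..}. carrier_vec i)"

definition vec_equiv :: "('a::semiring_1 vec \<times> 'a vec) set"
  where "vec_equiv = {(X, Y). X \<in> all_vecs \<and> Y \<in> all_vecs \<and>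
    (\<exists>s t. 0 < s \<and> 0 < t \<and> X \<otimes>\<^sub>v ones_vec s = Y \<otimes>\<^sub>v ones_vec t)}"

definition vec_class :: "'a::semiring_1 vec \<Rightarrow> 'a vec set"
  where "vec_class X = vec_equiv `` {X}"

definition vec_add :: "'a::semiring_1 vec \<Rightarrow> 'a vec \<Rightarrow> 'a vec"
  where "vec_add X Y = (let t = lcm (dim_vec X) (dim_vec Y) in
    X \<otimes>\<^sub>v ones_vec (t div dim_vec X) + Y \<otimes>\<^sub>v ones_vec (t div dim_vec Y))"

text \<open>Addition and scalar product of classes through representatives; independence of the
  representatives is \<open>class_add_vec_class\<close> and \<open>class_smult_vec_class\<close> below.\<close>

definition class_add :: "'a::semiring_1 vec set \<Rightarrow> 'a vec set \<Rightarrow> 'a vec set"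
  where "class_add A B = (\<Union>X\<in>A. \<Union>Y\<in>B. vec_class (vec_add X Y))"

definition class_smult :: "'a::semiring_1 \<Rightarrow> 'a vec set \<Rightarrow> 'a vec set"
  where "class_smult a A = (\<Union>X\<in>A. vec_class (a \<cdot>\<^sub>v X))"

text \<open>The ring multiplication and unit of the \<open>module\<close> record play no role for modules.\<close>

definition Omega :: "('a::semiring_1, 'a vec set) module"
  where "Omega = \<lparr>
    carrier = all_vecs // vec_equiv,
    mult = undefined,
    one = undefined,
    zero = vec_class (0\<^sub>v 1),
    add = class_add,
    smult = class_smult\<rparr>"

definition Omega_dim :: "nat \<Rightarrow> 'a::semiring_1 vec set set"
  where "Omega_dim i = vec_class ` carrier_vec i"

lemma all_vecs_iff: "X \<in> all_vecs \<longleftrightarrow> 0 < dim_vec X"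
  unfolding all_vecs_def carrier_vec_def UN_iff mem_Collect_eq atLeast_iff bex_simps
  by (simp only: Bex_def atLeast_iff One_nat_def Suc_le_eq ex_simps conj_commute) blast

lemma dim_kron_ones [simp]: "dim_vec (X \<otimes>\<^sub>v ones_vec s) = dim_vec X * s"
  by (simp add: kron_vec_def ones_vec_def)

lemma index_kron_ones [simp]:
  fixes X :: "'a::semiring_1 vec"
  assumes "k < dim_vec X * s"
  shows "(X \<otimes>\<^sub>v ones_vec s) $ k = X $ (k div s)"
proof -
  have "0 < s" using assms by (cases s) auto
  then show ?thesis using assms by (simp add: kron_vec_def ones_vec_def)
qed

lemma kron_ones_ones:
  fixes X :: "'a::semiring_1 vec"
  shows "X \<otimes>\<^sub>v ones_vec s \<otimes>\<^sub>v ones_vec u = X \<otimes>\<^sub>v ones_vec (s * u)"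
proof (rule eq_vecI)
  fix k assume "k < dim_vec (X \<otimes>\<^sub>v ones_vec (s * u))"
  then have k: "k < dim_vec X * (s * u)" by simp
  then have "k div u < dim_vec X * s"
    by (simp add: less_mult_imp_div_less mult.assoc)
  moreover have "k div u div s = k div (s * u)"
    by (simp only: div_mult2_eq[symmetric] mult.commute[of u s])
  moreover have "k < dim_vec X * s * u"
    using k by (simp only: mult.assoc)
  ultimately show "(X \<otimes>\<^sub>v ones_vec s \<otimes>\<^sub>v ones_vec u) $ k = (X \<otimes>\<^sub>v ones_vec (s * u)) $ k"
    using k by simp
qed (simp add: mult.assoc)

lemma add_kron_ones:
  fixes X Y :: "'a::semiring_1 vec"
  assumes "dim_vec X = dim_vec Y"
  shows "(X + Y) \<otimes>\<^sub>v ones_vec s = X \<otimes>\<^sub>v ones_vec s + Y \<otimes>\<^sub>v ones_vec s"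
  by (rule eq_vecI) (use assms in \<open>auto simp: less_mult_imp_div_less\<close>)

lemma smult_kron_ones:
  fixes X :: "'a::semiring_1 vec"
  shows "(a \<cdot>\<^sub>v X) \<otimes>\<^sub>v ones_vec s = a \<cdot>\<^sub>v (X \<otimes>\<^sub>v ones_vec s)"
  by (rule eq_vecI) (auto simp: less_mult_imp_div_less)

lemma vec_equivI:
  assumes "0 < dim_vec X" "0 < dim_vec Y" "0 < s" "0 < t"
    and "X \<otimes>\<^sub>v ones_vec s = Y \<otimes>\<^sub>v ones_vec t"
  shows "(X, Y) \<in> vec_equiv"
  using assms by (auto simp: vec_equiv_def all_vecs_iff)

lemma vec_equivE:
  assumes "(X, Y) \<in> vec_equiv"
  obtains s t where "0 < dim_vec X" "0 < dim_vec Y" "0 < s" "0 < t"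
    "X \<otimes>\<^sub>v ones_vec s = Y \<otimes>\<^sub>v ones_vec t"
  using assms by (auto simp: vec_equiv_def all_vecs_iff)

lemma equiv_vec_equiv: "equiv (all_vecs :: 'a::semiring_1 vec set) vec_equiv"
proof (rule Equiv_Relations.equivI)
  show "(vec_equiv :: ('a vec \<times> 'a vec) set) \<subseteq> all_vecs \<times> all_vecs"
    by (auto simp: vec_equiv_def)
  show "refl_on all_vecs (vec_equiv :: ('a vec \<times> 'a vec) set)"
    by (auto simp: refl_on_def all_vecs_iff intro: vec_equivI[of _ _ 1 1])
  show "sym (vec_equiv :: ('a vec \<times> 'a vec) set)"
  proof (rule symI)
    fix X Y :: "'a vec"
    assume "(X, Y) \<in> vec_equiv"
    then obtain s t where "0 < dim_vec X" "0 < dim_vec Y" "0 < s" "0 < t"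
      "X \<otimes>\<^sub>v ones_vec s = Y \<otimes>\<^sub>v ones_vec t"
      by (rule vec_equivE)
    then show "(Y, X) \<in> vec_equiv"
      by (intro vec_equivI[of Y X t s]) simp_all
  qed
  show "trans (vec_equiv :: ('a vec \<times> 'a vec) set)"
  proof (rule transI)
    fix X Y Z :: "'a vec"
    assume "(X, Y) \<in> vec_equiv" "(Y, Z) \<in> vec_equiv"
    then obtain s t u w where *: "0 < dim_vec X" "0 < dim_vec Z" "0 < s" "0 < t" "0 < u" "0 < w"
      and st: "X \<otimes>\<^sub>v ones_vec s = Y \<otimes>\<^sub>v ones_vec t"
      and uw: "Y \<otimes>\<^sub>v ones_vec u = Z \<otimes>\<^sub>v ones_vec w"
      by (elim vec_equivE) blast
    have "X \<otimes>\<^sub>v ones_vec (s * u) = Y \<otimes>\<^sub>v ones_vec (t * u)"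
      by (simp only: kron_ones_ones[symmetric] st)
    also have "\<dots> = Z \<otimes>\<^sub>v ones_vec (w * t)"
      by (simp only: kron_ones_ones[symmetric] uw mult.commute[of t u])
    finally have "X \<otimes>\<^sub>v ones_vec (s * u) = Z \<otimes>\<^sub>v ones_vec (w * t)" .
    with * show "(X, Z) \<in> vec_equiv"
      by (intro vec_equivI[of _ _ "s * u" "w * t"]) auto
  qed
qed

lemma dim_vec_add: "dim_vec (vec_add X Y) = lcm (dim_vec X) (dim_vec Y)"
  by (simp add: vec_add_def Let_def)

lemma vec_add_equiv_common:
  fixes X Y :: "'a::semiring_1 vec"
  assumes pos: "0 < dim_vec X" "0 < dim_vec Y" "0 < n"
    and eq: "dim_vec X * n = dim_vec Y * m"
  shows "(vec_add X Y, X \<otimes>\<^sub>v ones_vec n + Y \<otimes>\<^sub>v ones_vec m) \<in> vec_equiv"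
proof -
  define p q t where "p = dim_vec X" and "q = dim_vec Y" and "t = lcm p q"
  have "t dvd p * n"
    unfolding t_def p_def q_def by (rule lcm_least[OF dvd_triv_left]) (simp only: eq dvd_triv_left)
  then obtain c where c: "p * n = t * c" by (rule dvdE)
  have p: "p * (t div p) = t" and q: "q * (t div q) = t" by (simp_all add: t_def)
  have pq: "0 < p" "0 < q" using pos by (simp_all add: p_def q_def)
  have "p * n = p * (t div p * c)" by (simp only: c mult.assoc[symmetric] p)
  then have n: "n = t div p * c" using pq by simp
  have "q * m = q * (t div q * c)" 
    by (simp only: mult.assoc[symmetric] q c[symmetric]) (simp only: p_def q_def eq)
  then have m: "m = t div q * c" using pq by simp
  have t: "0 < t" using pq by (simp add: t_def lcm_pos_nat)
  have "0 < c" using n pos by (cases c) auto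
  have "vec_add X Y \<otimes>\<^sub>v ones_vec c = X \<otimes>\<^sub>v ones_vec n + Y \<otimes>\<^sub>v ones_vec m"
    unfolding vec_add_def Let_def p_def[symmetric] q_def[symmetric] t_def[symmetric]
    by (subst add_kron_ones) (use p q in \<open>simp_all add: kron_ones_ones n m p_def[symmetric] q_def[symmetric]\<close>)
  moreover have "Z \<otimes>\<^sub>v ones_vec 1 = Z" for Z :: "'a vec" by (rule eq_vecI) auto
  moreover have "0 < dim_vec (X \<otimes>\<^sub>v ones_vec n + Y \<otimes>\<^sub>v ones_vec m)"
    using pos eq[symmetric] by simp
  moreover have "0 < dim_vec (vec_add X Y)"
    using t by (simp add: dim_vec_add t_def p_def q_def)
  ultimately show ?thesis
    using \<open>0 < c\<close> by (intro vec_equivI[of _ _ c 1]) auto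
qed

lemma vec_add_cong:
  fixes X Y :: "'a::semiring_1 vec"
  assumes "(X, X') \<in> vec_equiv" "(Y, Y') \<in> vec_equiv"
  shows "(vec_add X Y, vec_add X' Y') \<in> vec_equiv"
proof -
  obtain s s' where X: "0 < dim_vec X" "0 < dim_vec X'" "0 < s" "0 < s'"
    and eX: "X \<otimes>\<^sub>v ones_vec s = X' \<otimes>\<^sub>v ones_vec s'"
    using assms(1) by (rule vec_equivE)
  obtain u u' where Y: "0 < dim_vec Y" "0 < dim_vec Y'" "0 < u" "0 < u'"
    and eY: "Y \<otimes>\<^sub>v ones_vec u = Y' \<otimes>\<^sub>v ones_vec u'"
    using assms(2) by (rule vec_equivE)
  define a b where "a = dim_vec X * s" and "b = dim_vec Y * u"
  have a': "a = dim_vec X' * s'" using arg_cong[OF eX, of dim_vec] by (simp add: a_def)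
  have b': "b = dim_vec Y' * u'" using arg_cong[OF eY, of dim_vec] by (simp add: b_def)
  have ab: "0 < a" "0 < b" using X Y by (simp_all add: a_def b_def)
  let ?S = "X \<otimes>\<^sub>v ones_vec (s * b) + Y \<otimes>\<^sub>v ones_vec (u * a)"
  let ?S' = "X' \<otimes>\<^sub>v ones_vec (s' * b) + Y' \<otimes>\<^sub>v ones_vec (u' * a)"
  have "dim_vec X * (s * b) = dim_vec Y * (u * a)"
    unfolding a_def b_def by (simp add: ac_simps)
  then have 1: "(vec_add X Y, ?S) \<in> vec_equiv"
    using X Y ab by (intro vec_add_equiv_common) auto
  have "dim_vec X' * (s' * b) = dim_vec Y' * (u' * a)"
    unfolding a' b' by (simp add: ac_simps)
  then have 2: "(vec_add X' Y', ?S') \<in> vec_equiv"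
    using X Y ab by (intro vec_add_equiv_common) auto
  have SS: "?S = ?S'" by (simp only: kron_ones_ones[symmetric] eX eY)
  have sym: "sym (vec_equiv :: ('a vec \<times> 'a vec) set)"
    and trans: "trans (vec_equiv :: ('a vec \<times> 'a vec) set)"
    using equiv_vec_equiv[where 'a = 'a] by (simp_all add: equiv_def)
  show ?thesis
    using transD[OF trans 1[unfolded SS] symD[OF sym 2]] .
qed

lemma vec_smult_cong:
  fixes X :: "'a::semiring_1 vec"
  assumes "(X, X') \<in> vec_equiv"
  shows "(a \<cdot>\<^sub>v X, a \<cdot>\<^sub>v X') \<in> vec_equiv"
proof -
  obtain s s' where X: "0 < dim_vec X" "0 < dim_vec X'" "0 < s" "0 < s'"
    and eX: "X \<otimes>\<^sub>v ones_vec s = X' \<otimes>\<^sub>v ones_vec s'"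
    using assms by (rule vec_equivE)
  then show ?thesis
    by (intro vec_equivI[of _ _ s s']) (simp_all add: smult_kron_ones)
qed

lemma vec_class_eq_iff:
  assumes "X \<in> all_vecs" "Y \<in> all_vecs"
  shows "vec_class X = vec_class Y \<longleftrightarrow> (X, Y) \<in> vec_equiv"
  unfolding vec_class_def using eq_equiv_class_iff[OF equiv_vec_equiv assms] .

lemma carrier_Omega: "carrier Omega = vec_class ` all_vecs"
  by (auto simp: Omega_def quotient_def vec_class_def)

lemma class_add_vec_class:
  assumes "X \<in> all_vecs" "Y \<in> all_vecs"
  shows "class_add (vec_class X) (vec_class Y) = vec_class (vec_add X Y)"
proof -
  have "vec_class (vec_add X' Y') = vec_class (vec_add X Y)"
    if "X' \<in> vec_class X" "Y' \<in> vec_class Y" for X' Y'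
  proof -
    have "(vec_add X Y, vec_add X' Y') \<in> vec_equiv"
      using that by (intro vec_add_cong) (simp_all add: vec_class_def)
    from equiv_class_eq[OF equiv_vec_equiv this] show ?thesis
      by (simp add: vec_class_def)
  qed
  moreover have "X \<in> vec_class X" "Y \<in> vec_class Y"
    unfolding vec_class_def using assms by (intro equiv_class_self[OF equiv_vec_equiv]; simp)+
  ultimately show ?thesis unfolding class_add_def by blast
qed

lemma class_smult_vec_class:
  assumes "X \<in> all_vecs"
  shows "class_smult a (vec_class X) = vec_class (a \<cdot>\<^sub>v X)"
proof -
  have "vec_class (a \<cdot>\<^sub>v X') = vec_class (a \<cdot>\<^sub>v X)" if "X' \<in> vec_class X" for X'
  proof -
    have "(a \<cdot>\<^sub>v X, a \<cdot>\<^sub>v X') \<in> vec_equiv"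
      using that by (intro vec_smult_cong) (simp add: vec_class_def)
    from equiv_class_eq[OF equiv_vec_equiv this] show ?thesis
      by (simp add: vec_class_def)
  qed
  moreover have "X \<in> vec_class X"
    unfolding vec_class_def using assms by (intro equiv_class_self[OF equiv_vec_equiv]; simp)+
  ultimately show ?thesis unfolding class_smult_def by blast
qed

end

(* Replacing X by its Kronecker product with an all-ones vector does not change its class, so
   finitely many classes always have representatives of one common dimension n. On such
   representatives the operations on classes are those of F^n, hence every vector space axiom of
   Omega is inherited from some F^n. The same replacement gives Omega_dim i <= Omega_dim j for
   i dvd j. *)
theory Submission
  imports Defs
begin

lemma kron_ones_1: "X \<otimes>\<^sub>v ones_vec 1 = (X :: 'a::semiring_1 vec)"
  by (rule eq_vecI) auto

lemma vec_class_kron_ones: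
  fixes X :: "'a::semiring_1 vec"
  assumes "0 < dim_vec X" "0 < s"
  shows "vec_class (X \<otimes>\<^sub>v ones_vec s) = vec_class X"
proof -
  have "(X \<otimes>\<^sub>v ones_vec s, X) \<in> vec_equiv"
    \<comment> \<open>The witnesses \<open>1\<close> and \<open>s\<close> bring both vectors to the
      common expansion \<open>X \<otimes>\<^sub>v ones_vec s\<close>.\<close>
    using assms by (intro vec_equivI[of _ _ 1 s]) (simp_all add: kron_ones_1[simplified])
  then show ?thesis
    using assms by (subst vec_class_eq_iff) (simp_all add: all_vecs_iff)
qed

text \<open>If j = i * s, then expanding a representative of dimension i by
  \<open>ones_vec s\<close> gives one of dimension j for the same class. Positivity of j forces both
  i and s to be positive.\<close>

lemma Omega_dim_mono:
  assumes "i dvd j" "0 < j"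
  shows "Omega_dim i \<subseteq> (Omega_dim j :: 'a::semiring_1 vec set set)"
proof
  fix A :: "'a vec set"
  assume "A \<in> Omega_dim i"
  then obtain X where X: "X \<in> carrier_vec i" "A = vec_class X"
    by (auto simp: Omega_dim_def)
  obtain s where s: "j = i * s" using assms(1) by (rule dvdE)
  have "A = vec_class (X \<otimes>\<^sub>v ones_vec s)"
    using X s assms(2) by (simp add: vec_class_kron_ones)
  moreover have "X \<otimes>\<^sub>v ones_vec s \<in> carrier_vec j"
    using X s by (intro carrier_vecI) simp
  ultimately show "A \<in> Omega_dim j" by (simp add: Omega_dim_def)
qed

lemma carrier_Omega_UN: "carrier Omega = (\<Union>i\<in>{1..}. Omega_dim i)"
  by (simp add: carrier_Omega all_vecs_def Omega_dim_def image_UN)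

lemma Omega_dim_subset_carrier: "0 < i \<Longrightarrow> Omega_dim i \<subseteq> carrier Omega"
  by (auto simp: carrier_Omega_UN Suc_le_eq)

text \<open>For equal dimensions the lcm is n itself, so both expansion factors are 1 and
  \<open>vec_add\<close> is the ordinary sum of vectors.\<close>

lemma class_add_carrier_vec:
  assumes "0 < n" "X \<in> carrier_vec n" "Y \<in> carrier_vec n"
  shows "class_add (vec_class X) (vec_class Y) = vec_class (X + Y)"
  using assms
  by (simp add: class_add_vec_class all_vecs_iff vec_add_def Let_def kron_ones_1[simplified])

lemma class_smult_carrier_vec:
  assumes "0 < n" "X \<in> carrier_vec n"
  shows "class_smult a (vec_class X) = vec_class (a \<cdot>\<^sub>v X)"
  using assms by (simp add: class_smult_vec_class all_vecs_iff)

text \<open>Expanding \<open>0\<^sub>v 1\<close> by \<open>ones_vec n\<close> gives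
  \<open>0\<^sub>v n\<close>. The zero of \<open>Omega\<close> can thus be taken in whichever
  dimension the other representatives have.\<close>

lemma vec_class_zero:
  assumes "0 < n"
  shows "vec_class (0\<^sub>v n) = vec_class (0\<^sub>v 1 :: 'a::semiring_1 vec)"
proof -
  have "0\<^sub>v 1 \<otimes>\<^sub>v ones_vec n = (0\<^sub>v n :: 'a vec)"
    by (rule eq_vecI) (simp_all add: less_mult_imp_div_less)
  with vec_class_kron_ones[of "0\<^sub>v 1 :: 'a vec" n] assms show ?thesis by simp
qed

text \<open>Reduces identities in \<open>Omega\<close> to identities in a single space of vectors.
  Three classes suffice because associativity, the longest axiom, involves three; for shorter axioms
  one class is repeated.\<close>

lemma carrier_Omega_E3:
  assumes "A \<in> carrier Omega" "B \<in> carrier Omega" "C \<in> carrier Omega"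
  obtains n X Y Z where "0 < n"
    "X \<in> carrier_vec n" "Y \<in> carrier_vec n" "Z \<in> carrier_vec n"
    "A = vec_class X" "B = vec_class Y" "C = vec_class Z"
proof -
  obtain i j k where ijk: "0 < i" "0 < j" "0 < k"
    "A \<in> Omega_dim i" "B \<in> Omega_dim j" "C \<in> Omega_dim k"
    using assms unfolding carrier_Omega_UN by (auto simp: Suc_le_eq)
  \<comment> \<open>Any positive common multiple of the three dimensions serves here; the product is
    the simplest.\<close>
  let ?n = "i * j * k"
  have "0 < ?n" using ijk by simp
  moreover have "A \<in> Omega_dim ?n" "B \<in> Omega_dim ?n" "C \<in> Omega_dim ?n"
    using ijk Omega_dim_mono[of i ?n] Omega_dim_mono[of j ?n] Omega_dim_mono[of k ?n] by auto
  ultimately show thesis unfolding Omega_dim_def by (elim imageE) (rule that)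
qed

lemma vec_class_in_carrier: "0 < n \<Longrightarrow> X \<in> carrier_vec n \<Longrightarrow> vec_class X \<in> carrier Omega"
  by (auto simp: carrier_Omega all_vecs_iff)

lemma Omega_sel [simp]:
  "zero Omega = vec_class (0\<^sub>v 1)" "add Omega = class_add" "smult Omega = class_smult"
  by (simp_all add: Omega_def)

lemma abelian_group_Omega: "abelian_group (Omega :: ('a::ring_1, 'a vec set) module)"
proof (rule abelian_groupI)
  show "\<zero>\<^bsub>Omega\<^esub> \<in> carrier (Omega :: ('a, 'a vec set) module)"
    by (simp add: vec_class_in_carrier[of 1, simplified])
next
  fix A B C :: "'a vec set"
  assume ABC: "A \<in> carrier Omega" "B \<in> carrier Omega" "C \<in> carrier Omega"
  from ABC show "(A \<oplus>\<^bsub>Omega\<^esub> B) \<oplus>\<^bsub>Omega\<^esub> C = A \<oplus>\<^bsub>Omega\<^esub> (B \<oplus>\<^bsub>Omega\<^esub> C)"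
    by (rule carrier_Omega_E3) (simp add: class_add_carrier_vec assoc_add_vec)
next
  fix A B :: "'a vec set"
  assume AB: "A \<in> carrier Omega" "B \<in> carrier Omega"
  \<comment> \<open>The class \<open>A\<close> is supplied twice to fill the three places.\<close>
  from AB(1) AB obtain n X Y where *: "0 < n" "X \<in> carrier_vec n" "Y \<in> carrier_vec n"
    "A = vec_class X" "B = vec_class Y" by (rule carrier_Omega_E3)
  then show "A \<oplus>\<^bsub>Omega\<^esub> B \<in> carrier Omega"
    by (simp add: class_add_carrier_vec vec_class_in_carrier[of n])
  show "A \<oplus>\<^bsub>Omega\<^esub> B = B \<oplus>\<^bsub>Omega\<^esub> A"
    using * by (simp add: class_add_carrier_vec comm_add_vec)
next
  fix A :: "'a vec set"
  assume A: "A \<in> carrier Omega"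
  from A A A obtain n X where *: "0 < n" "X \<in> carrier_vec n" "A = vec_class X"
    by (rule carrier_Omega_E3)
  then show "\<zero>\<^bsub>Omega\<^esub> \<oplus>\<^bsub>Omega\<^esub> A = A"
    by (simp add: vec_class_zero[of n, symmetric, simplified] class_add_carrier_vec)
  \<comment> \<open>The additive inverse comes from negating a representative; the sum is then the
    class of \<open>0\<^sub>v n\<close>.\<close>
  have "vec_class (- X) \<oplus>\<^bsub>Omega\<^esub> A = \<zero>\<^bsub>Omega\<^esub>"
    using * by (simp add: vec_class_zero[of n, symmetric, simplified] class_add_carrier_vec)
  then show "\<exists>B\<in>carrier Omega. B \<oplus>\<^bsub>Omega\<^esub> A = \<zero>\<^bsub>Omega\<^esub>"
    using * vec_class_in_carrier[of n "- X"] by auto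
qed

lemma module_Omega: "module (class_ring :: 'a::comm_ring_1 ring) Omega"
proof (rule moduleI)
  show "cring (class_ring :: 'a ring)" by (rule class_cring.is_cring)
  show "abelian_group (Omega :: ('a, 'a vec set) module)" by (rule abelian_group_Omega)
next
  fix a b :: 'a and A :: "'a vec set"
  assume A: "A \<in> carrier Omega"
  from A A A obtain n X where *: "0 < n" "X \<in> carrier_vec n" "A = vec_class X"
    by (rule carrier_Omega_E3)
  then show "a \<odot>\<^bsub>Omega\<^esub> A \<in> carrier Omega"
    by (simp add: class_smult_carrier_vec vec_class_in_carrier[of n])
  show "(a \<oplus>\<^bsub>class_ring\<^esub> b) \<odot>\<^bsub>Omega\<^esub> A = (a \<odot>\<^bsub>Omega\<^esub> A) \<oplus>\<^bsub>Omega\<^esub> (b \<odot>\<^bsub>Omega\<^esub> A)"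
    using * by (simp add: class_smult_carrier_vec class_add_carrier_vec add_smult_distrib_vec)
  show "(a \<otimes>\<^bsub>class_ring\<^esub> b) \<odot>\<^bsub>Omega\<^esub> A = a \<odot>\<^bsub>Omega\<^esub> (b \<odot>\<^bsub>Omega\<^esub> A)"
    using * by (simp add: class_smult_carrier_vec smult_smult_assoc)
  show "\<one>\<^bsub>class_ring\<^esub> \<odot>\<^bsub>Omega\<^esub> A = A"
    using * by (simp add: class_smult_carrier_vec)
next
  fix a :: 'a and A B :: "'a vec set"
  assume AB: "A \<in> carrier Omega" "B \<in> carrier Omega"
  from AB(1) AB obtain n X Y where *: "0 < n" "X \<in> carrier_vec n" "Y \<in> carrier_vec n"
    "A = vec_class X" "B = vec_class Y" by (rule carrier_Omega_E3)
  then show "a \<odot>\<^bsub>Omega\<^esub> (A \<oplus>\<^bsub>Omega\<^esub> B) = (a \<odot>\<^bsub>Omega\<^esub> A) \<oplus>\<^bsub>Omega\<^esub> (a \<odot>\<^bsub>Omega\<^esub> B)"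
    by (simp add: class_smult_carrier_vec class_add_carrier_vec smult_add_distrib_vec)
qed

lemma vectorspace_Omega: "vectorspace (class_ring :: 'a::field ring) Omega"
  by (intro vectorspace.intro module_Omega class_field)

text \<open>Sums and multiples of representatives in \<open>carrier_vec i\<close> stay in
  \<open>carrier_vec i\<close>, and the zero class is also that of
  \<open>0\<^sub>v i\<close>.\<close>

lemma submodule_Omega_dim:
  assumes "0 < i"
  shows "submodule (class_ring :: 'a::comm_ring_1 ring) (Omega_dim i) Omega"
proof (rule submodule.intro)
  show "module (class_ring :: 'a ring) Omega" by (rule module_Omega)
  show "Omega_dim i \<subseteq> carrier (Omega :: ('a, 'a vec set) module)"
    by (rule Omega_dim_subset_carrier[OF assms])
  show "\<zero>\<^bsub>Omega\<^esub> \<in> (Omega_dim i :: 'a vec set set)"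
    using vec_class_zero[OF assms, where 'a = 'a] by (auto simp: Omega_dim_def)
  show "A \<oplus>\<^bsub>Omega\<^esub> B \<in> Omega_dim i"
    if "A \<in> Omega_dim i" "B \<in> Omega_dim i" for A B :: "'a vec set"
    using that assms by (auto simp: Omega_dim_def class_add_carrier_vec)
  show "a \<odot>\<^bsub>Omega\<^esub> A \<in> Omega_dim i" if "A \<in> Omega_dim i" for a and A :: "'a vec set"
    using that assms by (auto simp: Omega_dim_def class_smult_carrier_vec)
qed

lemma subspace_Omega_dim:
  assumes "0 < i"
  shows "subspace (class_ring :: 'a::field ring) (Omega_dim i) Omega"
  by (intro subspace.intro vectorspace_Omega submodule_Omega_dim assms)

text \<open>Passing from V to \<open>vs W\<close> changes only the carrier, not the operations. The
  closure properties of U therefore carry over, and the only new requirement is that U lies in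
  W.\<close>

lemma (in vectorspace) subspace_nested:
  assumes U: "subspace K U V" and W: "subspace K W V" and "U \<subseteq> W"
  shows "subspace K U (vs W)"
proof (rule subspace.intro)
  show vsW: "vectorspace K (vs W)" by (rule subspace_is_vs[OF W])
  have sub: "submodule K U V" using U by (rule is_module)
  show "submodule K U (vs W)"
  proof (rule submodule.intro)
    show "module K (vs W)" using vsW by (rule vectorspace.axioms)
  qed (use \<open>U \<subseteq> W\<close> in \<open>simp_all add: submodule.m_closed[OF sub]
      submodule.zero_closed[OF sub] submodule.smult_closed[OF sub]\<close>)
qed

theorem theorem217:
  shows "vectorspace (class_ring :: 'a::field_char_0 ring) Omega \<and>
    (\<forall>i\<ge>1. subspace (class_ring :: 'a ring) (Omega_dim i) Omega) \<and>
    (\<forall>i\<ge>1. \<forall>j\<ge>1. i dvd j \<longrightarrow>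
      subspace (class_ring :: 'a ring) (Omega_dim i) (Omega\<lparr>carrier := Omega_dim j\<rparr>))"
proof (intro conjI allI impI)
  show "vectorspace (class_ring :: 'a ring) Omega" by (rule vectorspace_Omega)
  show "subspace (class_ring :: 'a ring) (Omega_dim i) Omega" if "i \<ge> 1" for i
    using that by (intro subspace_Omega_dim) simp
  \<comment> \<open>Both sets are subspaces of \<open>Omega\<close>, and divisibility yields the
    inclusion between them, so nesting applies.\<close>
  show "subspace (class_ring :: 'a ring) (Omega_dim i) (Omega\<lparr>carrier := Omega_dim j\<rparr>)"
    if "i \<ge> 1" "j \<ge> 1" "i dvd j" for i j
    using that
    by (intro vectorspace.subspace_nested[OF vectorspace_Omega] subspace_Omega_dim Omega_dim_mono)
      simp_all
qed

end
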